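(* If $d\ge 2$ is an even integer, then $\mathcal{C}_d(d-1,d)=\mathbb{Z}^+$.
   Context: Orthogonality and the norm $\|\cdot\|$ refer to the standard Euclidean inner product. For positive integers $d,N,n$, $\mathcal{O}_d(N,n)$ denotes the collection of sets $\mathcal{S}\subset\mathbb{Z}^d$ of pairwise orthogonal vectors, each of norm $\sqrt{N}$, with $\#\mathcal{S}=n$. For $1\le n_1<n_2\le d$, \[ \mathcal{C}_d(n_1,n_2)=\big\{N\in\mathbb{Z}^+ : \forall\, \mathcal{S}\in\mathcal{O}_d(N,n_1)\ \exists\, \mathcal{S}'\in\mathcal{O}_d(N,n_2)\text{ with }\mathcal{S}'\supset\mathcal{S}\big\} \] (so $N$ belongs to this set vacuously if $\mathcal{O}_d(N,n_1)$ is empty). $\mathbb{Z}^+$ is the set of positive integers. *)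

theory Defs
  imports "HOL-Analysis.Analysis"
begin

text \<open>The dimension \<open>d\<close> is the cardinality of the finite index type \<open>'n\<close>, and
  \<open>\<int>\<^sup>d\<close> is regarded as a subset of Euclidean space \<open>\<real>\<^sup>d\<close>.\<close>

definition integer_lattice :: "(real ^ 'n) set"
  where "integer_lattice = {v. \<forall>i. v $ i \<in> \<int>}"

definition ortho_sets :: "nat \<Rightarrow> nat \<Rightarrow> (real ^ 'n) set set"  (\<open>\<O>\<close>)
  where "\<O> N n = {S. S \<subseteq> integer_lattice \<and> pairwise orthogonal S \<and>
    (\<forall>v\<in>S. norm v = sqrt (real N)) \<and> finite S \<and> card S = n}"

text \<open>The type argument is needed because the dimension does not occur in the type of the
  result. The definition is meant for \<open>1 \<le> n\<^sub>1 < n\<^sub>2 \<le> d\<close>.\<close>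

definition extendable_norms :: "'n::finite itself \<Rightarrow> nat \<Rightarrow> nat \<Rightarrow> nat set"  (\<open>\<C>\<close>)
  where "\<C> TYPE('n) n\<^sub>1 n\<^sub>2 =
    {N. 0 < N \<and> (\<forall>S \<in> (\<O> N n\<^sub>1 :: (real ^ 'n) set set). \<exists>S' \<in> \<O> N n\<^sub>2. S \<subseteq> S')}"

end

theory Submission
  imports Defs
begin

text \<open>Let \<open>d\<close> be even and let \<open>S\<close> consist of \<open>d - 1\<close> pairwise orthogonal integer vectors of squared
  norm \<open>N\<close>. The vectors \<open>N e\<^sub>j - (\<Sum>v\<in>S. v\<^sub>j v)\<close> are integral and orthogonal to \<open>S\<close>, and one of them,
  \<open>w\<close> say, is nonzero by a trace computation. The determinant of the matrix with rows
  \<open>insert w S\<close> is an integer with square \<open>N ^ (d - 1) * \<bar>w\<bar>\<^sup>2\<close>, so \<open>N * \<bar>w\<bar>\<^sup>2\<close> is the square of a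
  rational since \<open>d\<close> is even, and a rational multiple \<open>x\<close> of \<open>w\<close> has squared norm \<open>N\<close>. The columns
  of the matrix with rows \<open>insert x S\<close> also have squared norm \<open>N\<close>, so the squares of the
  coordinates of \<open>x\<close> are integers. Being rational, the coordinates themselves are integers.\<close>

text \<open>As the square root of an integer, \<open>\<bar>x\<bar>\<close> is an algebraic integer,
  and rational algebraic integers are integers.\<close>

lemma Rats_power2_Ints_imp_Ints:
  fixes x :: real
  assumes "x \<in> \<rat>" and "x\<^sup>2 \<in> \<int>"
  shows "x \<in> \<int>"
proof -
  have "algebraic_int \<bar>x\<bar>"
    using algebraic_int_sqrt[OF int_imp_algebraic_int[OF assms(2)]] by simp
  then show ?thesis using assms(1) by (simp add: rational_algebraic_int_is_int)
qed

lemma det_Ints: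
  fixes A :: "real ^ 'n ^ 'n"
  assumes "\<And>i j. A $ i $ j \<in> \<int>"
  shows "det A \<in> \<int>"
  unfolding det_def using assms by (intro Ints_sum Ints_mult Ints_prod) auto

lemma inner_Ints:
  assumes "v \<in> integer_lattice" and "w \<in> integer_lattice"
  shows "v \<bullet> w \<in> \<int>"
  using assms unfolding inner_vec_def integer_lattice_def by (auto intro!: Ints_sum)

text \<open>This lets the elements of \<open>B\<close> serve as the rows of a square matrix.\<close>

lemma orthogonal_set_enumeration:
  fixes B :: "'a::real_inner set"
  assumes "pairwise orthogonal B" and "card B = CARD('n::finite)"
  shows "\<exists>h. bij_betw h (UNIV :: 'n set) B \<and> (\<forall>i. h i \<in> B) \<and> (\<forall>i j. i \<noteq> j \<longrightarrow> h i \<bullet> h j = 0)"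
proof -
  \<comment> \<open>An infinite set would have \<open>card\<close> equal to 0, whereas
    \<open>CARD('n)\<close> is positive.\<close>
  have "finite B" using assms(2) card_gt_0_iff[of B] by simp
  then obtain h where h: "bij_betw h (UNIV :: 'n set) B"
    using finite_same_card_bij[of "UNIV :: 'n set" B] assms(2) by auto
  then have mem: "h i \<in> B" for i by (auto simp: bij_betw_def)
  have "h i \<bullet> h j = 0" if "i \<noteq> j" for i j
  proof -
    have "h i \<noteq> h j" using h that by (auto simp: bij_betw_def inj_on_def)
    then show ?thesis using pairwiseD[OF assms(1) mem mem] by (simp add: orthogonal_def)
  qed
  then show ?thesis using h mem by blast
qed

text \<open>Take for \<open>k\<close> the determinant of the matrix with rows \<open>B\<close>: its
  product with its transpose is diagonal, with the squared norms as entries.\<close>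

lemma orthogonal_set_prod_norm_square:
  fixes B :: "(real ^ 'n) set"
  assumes "pairwise orthogonal B" and "card B = CARD('n)" and "B \<subseteq> integer_lattice"
  obtains k where "k \<in> \<int>" and "k\<^sup>2 = (\<Prod>v\<in>B. v \<bullet> v)"
proof -
  obtain h :: "'n \<Rightarrow> real ^ 'n" where h: "bij_betw h UNIV B"
    and mem: "\<And>i. h i \<in> B" and orth: "\<And>i j. i \<noteq> j \<Longrightarrow> h i \<bullet> h j = 0"
    using orthogonal_set_enumeration[OF assms(1,2)] by blast
  define A :: "real ^ 'n ^ 'n" where "A = (\<chi> i. h i)"
  have entry: "(A ** transpose A) $ i $ j = h i \<bullet> h j" for i j
    by (simp add: A_def matrix_matrix_mult_def transpose_def inner_vec_def)
  have "(det A)\<^sup>2 = det (A ** transpose A)"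
    by (simp add: det_mul power2_eq_square)
  also have "\<dots> = (\<Prod>i\<in>UNIV. h i \<bullet> h i)"
    using orth by (simp add: det_diagonal entry)
  also have "\<dots> = (\<Prod>v\<in>B. v \<bullet> v)"
    using prod.reindex_bij_betw[OF h, of "\<lambda>v. v \<bullet> v"] .
  finally have "(det A)\<^sup>2 = (\<Prod>v\<in>B. v \<bullet> v)" .
  moreover have "det A \<in> \<int>"
    using mem assms(3) by (intro det_Ints) (auto simp: A_def integer_lattice_def)
  ultimately show ?thesis using that by blast
qed

text \<open>Dividing by \<open>r\<close> makes the rows orthonormal; a square matrix with
  orthonormal rows has orthonormal columns too.\<close>

lemma orthogonal_set_sum_coordinate_squares:
  fixes B :: "(real ^ 'n) set"
  assumes "pairwise orthogonal B" and "card B = CARD('n)"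
    and "\<And>v. v \<in> B \<Longrightarrow> norm v = r" and "r > 0"
  shows "(\<Sum>v\<in>B. (v $ j)\<^sup>2) = r\<^sup>2"
proof -
  obtain h :: "'n \<Rightarrow> real ^ 'n" where h: "bij_betw h UNIV B"
    and mem: "\<And>i. h i \<in> B" and orth: "\<And>i j. i \<noteq> j \<Longrightarrow> h i \<bullet> h j = 0"
    using orthogonal_set_enumeration[OF assms(1,2)] by blast
  define A :: "real ^ 'n ^ 'n" where "A = (\<chi> i. h i /\<^sub>R r)"
  have row: "row i A = h i /\<^sub>R r" for i by (simp add: A_def row_def vec_eq_iff)
  have "orthogonal_matrix A"
    unfolding orthogonal_matrix_orthonormal_rows
    using orth assms(3)[OF mem] assms(4) by (simp add: row orthogonal_def)
  then have "norm (column j A) = 1"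
    unfolding orthogonal_matrix_orthonormal_columns by blast
  then have "1 = column j A \<bullet> column j A" by (simp add: dot_square_norm)
  also have "\<dots> = (\<Sum>i\<in>UNIV. (h i $ j)\<^sup>2) / r\<^sup>2"
    by (simp add: inner_vec_def column_def A_def power2_eq_square sum_divide_distrib field_simps)
  also have "(\<Sum>i\<in>UNIV. (h i $ j)\<^sup>2) = (\<Sum>v\<in>B. (v $ j)\<^sup>2)"
    using sum.reindex_bij_betw[OF h, of "\<lambda>v. (v $ j)\<^sup>2"] .
  finally show ?thesis using assms(4) by (simp add: field_simps)
qed

lemma orthogonal_complement_lattice_vector:
  fixes S :: "(real ^ 'n) set"
  assumes S: "S \<subseteq> integer_lattice" "pairwise orthogonal S" "finite S" "card S < CARD('n)"
    and N: "\<And>v. v \<in> S \<Longrightarrow> v \<bullet> v = real N" "N > 0"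
  obtains w where "w \<in> integer_lattice" and "w \<noteq> 0" and "\<And>v. v \<in> S \<Longrightarrow> orthogonal w v"
proof -
  \<comment> \<open>This is \<open>N\<close> times the projection of the basis vector
    \<open>axis j 1\<close> onto the complement of \<open>S\<close>; the factor \<open>N\<close>
    clears the denominators.\<close>
  define w where "w j = real N *\<^sub>R axis j 1 - (\<Sum>v\<in>S. v $ j *\<^sub>R v)" for j :: 'n
  have "w j \<in> integer_lattice" for j
    using S(1) unfolding w_def integer_lattice_def
    by (auto simp: axis_def intro!: Ints_diff Ints_sum Ints_mult)
  moreover have "orthogonal (w j) v" if "v \<in> S" for j v
  proof -
    have "(\<Sum>u\<in>S. u $ j * (u \<bullet> v)) = (\<Sum>u\<in>S. if u = v then v $ j * real N else 0)"
      using S(2) N(1) that by (intro sum.cong) (auto simp: pairwise_def orthogonal_def)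
    also have "\<dots> = v $ j * real N" using S(3) that by simp
    finally show ?thesis
      by (simp add: orthogonal_def w_def inner_diff_left inner_sum_left inner_axis')
  qed
  moreover have "\<exists>j. w j \<noteq> 0"
  proof (rule ccontr)
    \<comment> \<open>The sum of \<open>w j $ j\<close> is the trace of the scaled projection,
      namely \<open>N\<close> times \<open>CARD('n) - card S\<close>, which is positive.\<close>
    assume "\<nexists>j. w j \<noteq> 0"
    then have "0 = (\<Sum>j\<in>UNIV. w j $ j)" by simp
    also have "\<dots> = (\<Sum>j\<in>(UNIV :: 'n set). real N) - (\<Sum>j\<in>UNIV. \<Sum>v\<in>S. v $ j * v $ j)"
      by (simp add: w_def axis_def sum_subtractf)
    also have "(\<Sum>j\<in>UNIV. \<Sum>v\<in>S. v $ j * v $ j) = (\<Sum>v\<in>S. v \<bullet> v)"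
      by (subst sum.swap) (simp add: inner_vec_def)
    finally have "real CARD('n) * real N = real (card S) * real N"
      using N(1) by simp
    then show False using N(2) S(4) by simp
  qed
  ultimately show ?thesis using that by blast
qed

lemma even_dimension_extend:
  fixes S :: "(real ^ 'n) set"
  assumes "even CARD('n)" and N: "N > 0" and S: "S \<in> \<O> N (CARD('n) - 1)"
  shows "\<exists>S' \<in> \<O> N CARD('n). S \<subseteq> S'"
proof -
  have lat: "S \<subseteq> integer_lattice" and orth: "pairwise orthogonal S"
    and norm: "\<And>v. v \<in> S \<Longrightarrow> norm v = sqrt (real N)"
    and fin: "finite S" and card: "card S = CARD('n) - 1"
    using S by (auto simp: ortho_sets_def)
  have sq: "v \<bullet> v = real N" if "v \<in> S" for v
    using norm[OF that] by (simp add: dot_square_norm)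
  have "card S < CARD('n)" using card by simp
  then obtain w where w: "w \<in> integer_lattice" "w \<noteq> 0" "\<And>v. v \<in> S \<Longrightarrow> orthogonal w v"
    using orthogonal_complement_lattice_vector[OF lat orth fin _ sq N] by blast
  \<comment> \<open>This is used twice, for the lattice vector \<open>w\<close> and for its multiple
    \<open>x\<close>. A member of \<open>S\<close> orthogonal to all of \<open>S\<close> would be
    orthogonal to itself, hence zero.\<close>
  have insert: "x \<notin> S" "pairwise orthogonal (insert x S)" "card (insert x S) = CARD('n)"
    if "x \<noteq> 0" "\<And>v. v \<in> S \<Longrightarrow> orthogonal x v" for x
  proof -
    show "x \<notin> S" using that by (metis orthogonal_self)
    then show "card (insert x S) = CARD('n)" using fin card by simp
    show "pairwise orthogonal (insert x S)"
      using that(2) orth by (simp add: pairwise_insert orthogonal_commute)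
  qed
  note insert_w = insert[OF w(2,3)]
  obtain k where k: "k \<in> \<int>" "k\<^sup>2 = (\<Prod>v\<in>insert w S. v \<bullet> v)"
    using orthogonal_set_prod_norm_square[OF insert_w(2,3)] lat w(1) by blast
  obtain m where m: "CARD('n) = 2 * m" using assms(1) by (elim evenE)
  have "m > 0" using m zero_less_card_finite[where 'a = 'n] by linarith
  \<comment> \<open>Evenness enters here: the exponent of \<open>N\<close> is odd, so
    \<open>N ^ (CARD('n) - 1)\<close> is \<open>N\<close> times a square.\<close>
  then have exp: "CARD('n) - 1 = Suc (2 * (m - 1))" using m by simp
  have k2: "k\<^sup>2 = (w \<bullet> w) * (real N * (real N ^ (m - 1))\<^sup>2)"
    using k(2) insert_w(1) fin sq card exp by (simp add: power_even_eq)
  \<comment> \<open>The scaling must satisfy \<open>c\<^sup>2 * (w \<bullet> w) = N\<close>; by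
    \<open>k2\<close>, this \<open>c\<close> is a square root of \<open>N / (w \<bullet> w)\<close>
    built from integers, hence rational.\<close>
  define c where "c = k / (real N ^ (m - 1) * (w \<bullet> w))"
  define x where "x = c *\<^sub>R w"
  have pos: "w \<bullet> w > 0" using w(2) by simp
  have "x \<bullet> x = c\<^sup>2 * (w \<bullet> w)" by (simp add: x_def power2_eq_square)
  also have "\<dots> = real N"
    unfolding c_def power_divide power_mult_distrib k2
    using pos N by (simp add: power2_eq_square[of "w \<bullet> w"])
  finally have xx: "x \<bullet> x = real N" .
  have "x \<noteq> 0" using xx N by auto
  moreover have "orthogonal x v" if "v \<in> S" for v
    using w(3)[OF that] by (simp add: x_def orthogonal_def)
  ultimately have insert_x: "x \<notin> S" "pairwise orthogonal (insert x S)"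
    "card (insert x S) = CARD('n)"
    using insert by blast+
  have norm_x: "norm v = sqrt (real N)" if "v \<in> insert x S" for v
    using that norm xx by (auto simp: norm_eq_sqrt_inner)
  have "x $ j \<in> \<int>" for j
  proof (rule Rats_power2_Ints_imp_Ints)
    have "c \<in> \<rat>"
      unfolding c_def using k(1) inner_Ints[OF w(1) w(1)] Ints_subset_Rats
      by (intro Rats_divide Rats_mult Rats_power) auto
    moreover have "w $ j \<in> \<rat>"
      using w(1) Ints_subset_Rats by (auto simp: integer_lattice_def)
    ultimately show "x $ j \<in> \<rat>" by (simp add: x_def)
    \<comment> \<open>Column \<open>j\<close> has squared norm \<open>N\<close>, and all its entries
      other than \<open>x $ j\<close> are already known to be integers.\<close>
    have "(\<Sum>v\<in>insert x S. (v $ j)\<^sup>2) = (sqrt (real N))\<^sup>2"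
      by (rule orthogonal_set_sum_coordinate_squares[OF insert_x(2,3) norm_x]) (use N in auto)
    then have "(x $ j)\<^sup>2 = real N - (\<Sum>v\<in>S. (v $ j)\<^sup>2)"
      using fin insert_x(1) by simp
    then show "(x $ j)\<^sup>2 \<in> \<int>"
      using lat by (auto simp: integer_lattice_def intro!: Ints_diff Ints_sum Ints_power)
  qed
  then have "insert x S \<subseteq> integer_lattice" using lat by (simp add: integer_lattice_def)
  then have "insert x S \<in> \<O> N CARD('n)"
    using insert_x norm_x fin by (simp add: ortho_sets_def)
  then show ?thesis by blast
qed

theorem corollary2p4:
  assumes "CARD('n::finite) \<ge> 2" and "even CARD('n)"
  shows "\<C> TYPE('n) (CARD('n) - 1) CARD('n) = {N. 0 < N}"
  using even_dimension_extend[OF assms(2)] by (auto simp: extendable_norms_def)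

end
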